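(* For all integers $n\geq 0$, \begin{align*} a_{37}(43n+12)&\equiv 0 \pmod{43}, & a_{41}(47n+21)&\equiv 0 \pmod{47}, \\ a_{53}(59n+56)&\equiv 0 \pmod{59}, & a_{61}(67n+19)&\equiv 0 \pmod{67},\\ a_{65}(71n+32)&\equiv 0 \pmod{71}, & a_{73}(79n+62)&\equiv 0 \pmod{79},\\ a_{77}(83n+79)&\equiv 0 \pmod{83}. & & \end{align*}
   Context: For an integer $k\geq 1$ let $f_k:=\prod_{n\geq 1}(1-q^{kn})$. For an integer $c\geq 1$, the generalized cubic partition function $a_c(n)$ is defined by the generating function $\sum_{n\geq 0}a_c(n)q^n=\dfrac{1}{f_1f_2^{c-1}}$ (so $a_c(0)=1$). *)

theory Defs
  imports "HOL-Computational_Algebra.Formal_Power_Series"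
begin

text \<open>The infinite product f_k = prod_{n>=1} (1 - q^(k n)) as a formal power series (over the
  rationals, so that it can be inverted). Its n-th coefficient is the n-th coefficient of the
  finite partial product up to index n (all further factors are congruent to 1 modulo q^(n+1));
  this is the X-adic limit of the partial products.\<close>
definition eta_prod :: "nat \<Rightarrow> rat fps" where
  "eta_prod k = Abs_fps (\<lambda>n. fps_nth (\<Prod>m\<in>{1..n}. (1 - fps_X ^ (k * m))) n)"

text \<open>Generalized cubic partition function: sum a_c(n) q^n = 1 / (f_1 f_2^(c-1)).
  (The values are integers since the constant term of the denominator is 1.)\<close>
definition a_gen :: "nat \<Rightarrow> nat \<Rightarrow> rat" where
  "a_gen c n = fps_nth (inverse (eta_prod 1 * eta_prod 2 ^ (c - 1))) n"

definition zero_mod :: "rat \<Rightarrow> int \<Rightarrow> bool" where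
  "zero_mod x m \<longleftrightarrow> (\<exists>k::int. x = of_int (m * k))"

end

theory Submission
  imports Defs "HOL-Number_Theory.Residues"
begin

text \<open>
  Let \<open>p = c + 6\<close>, a prime with \<open>p \<equiv> 3 (mod 4)\<close>. As \<open>f\<^sub>2\<^sup>p \<equiv> f\<^sub>2\<^sub>p (mod p)\<close>,
  the generating function \<open>1 / (f\<^sub>1 f\<^sub>2\<^bsup>p-7\<^esup>)\<close> is congruent to \<open>F / f\<^sub>2\<^sub>p\<close> with
  \<open>F = f\<^sub>2\<^sup>7 / f\<^sub>1\<close>, and it suffices that \<open>p\<close> divides the \<open>n\<close>-th coefficient of \<open>F\<close>
  whenever \<open>p\<close> divides \<open>24n + 13\<close>. With \<open>D = q d/dq\<close> one has the Wronskian identity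
  \<open>f\<^sub>1(q) Df\<^sub>1(-q) - f\<^sub>1(-q) Df\<^sub>1(q) = 2q F(q\<^sup>2)\<close>.
  By Euler's pentagonal number theorem the coefficients of the left-hand side are signed sums of
  \<open>(y\<^sup>2 - x\<^sup>2) / 24\<close> over \<open>x\<^sup>2 + y\<^sup>2 = 2 (24n + 13)\<close>, and \<open>p | x\<^sup>2 + y\<^sup>2\<close> forces \<open>p | x\<close>
  and \<open>p | y\<close>.

  The Wronskian identity follows from \<open>\<phi>(-q) = f\<^sub>1\<^sup>2 / f\<^sub>2\<close>, since the Wronskian of \<open>\<phi>(-q)\<close> and
  \<open>\<phi>(q)\<close> is \<open>4q f\<^sub>4\<^sup>6\<close> by Jacobi's series for \<open>f\<^sub>4\<^sup>3\<close> and a rotation of the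
  summation lattice. The three theta series are limits of a finite form of the triple product.
\<close>

section \<open>Gaussian binomials and the finite Jacobi triple product\<close>

text \<open>The q-Pascal rule serves as definition, so Gaussian binomials exist in every commutative
  ring, with no division.\<close>

fun qbin :: "'a::comm_ring_1 \<Rightarrow> nat \<Rightarrow> nat \<Rightarrow> 'a" where
  "qbin q n 0 = 1"
| "qbin q 0 (Suc k) = 0"
| "qbin q (Suc n) (Suc k) = qbin q n k + q ^ Suc k * qbin q n (Suc k)"

definition qfac :: "'a::comm_ring_1 \<Rightarrow> nat \<Rightarrow> 'a" where
  "qfac q n = (\<Prod>m\<in>{1..n}. 1 - q ^ m)"

lemma qfac_0 [simp]: "qfac q 0 = 1"
  by (simp add: qfac_def)

lemma qfac_Suc [simp]: "qfac q (Suc n) = qfac q n * (1 - q ^ Suc n)"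
  by (simp add: qfac_def)

lemma qbin_eq_0: "n < k \<Longrightarrow> qbin q n k = 0"
  by (induction q n k rule: qbin.induct) auto

lemma qbin_self: "qbin q n n = 1"
  by (induction n) (simp_all add: qbin_eq_0)

text \<open>The usual quotient formula with denominators cleared. The two Pascal summands contribute
  \<open>1 - q ^ Suc k\<close> and \<open>q ^ Suc k * (1 - q ^ Suc r)\<close>, which add up to
  \<open>1 - q ^ Suc n\<close>.\<close>

lemma qbin_qfac: "k \<le> n \<Longrightarrow> qbin q n k * (qfac q k * qfac q (n - k)) = qfac q n"
proof (induction q n k rule: qbin.induct)
  case (3 q n k)
  show ?case
  proof (cases "k = n")
    case True
    then show ?thesis by (simp add: qbin_eq_0 qbin_self)
  next
    case False
    with 3 have kn: "k < n" by simp
    then obtain r where r: "n = Suc (k + r)" by (metis less_iff_Suc_add)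
    have A: "qbin q n k * (qfac q k * (qfac q r * (1 - q ^ Suc r))) = qfac q n"
      using 3(1) r by simp
    have B: "qbin q n (Suc k) * ((qfac q k * (1 - q ^ Suc k)) * qfac q r) = qfac q n"
      using 3(2) r by simp
    have "qbin q (Suc n) (Suc k) * (qfac q (Suc k) * qfac q (Suc n - Suc k))
        = (1 - q ^ Suc k) * (qbin q n k * (qfac q k * (qfac q r * (1 - q ^ Suc r))))
        + (q ^ Suc k * (1 - q ^ Suc r)) *
            (qbin q n (Suc k) * ((qfac q k * (1 - q ^ Suc k)) * qfac q r))"
      using r by (simp add: ring_distribs mult_ac)
    also have "\<dots> = ((1 - q ^ Suc k) + q ^ Suc k * (1 - q ^ Suc r)) * qfac q n"
      unfolding A B by (simp add: ring_distribs)
    also have "(1 - q ^ Suc k) + q ^ Suc k * (1 - q ^ Suc r) = 1 - q ^ Suc n"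
      using r by (simp add: algebra_simps power_add)
    finally show ?thesis by (simp add: mult.commute)
  qed
qed auto

lemma triangle_Suc: "Suc k * k div 2 = k * (k - 1) div 2 + k"
proof -
  have "Suc k * k = k * (k - 1) + 2 * k" by (cases k) (auto simp: algebra_simps)
  then show ?thesis by simp
qed

text \<open>Splitting off the factor \<open>i = 0\<close> leaves the product for
  \<open>b * q\<close>, so the induction generalises \<open>b\<close>; the q-Pascal rule then merges
  the two sums.\<close>

lemma q_binomial_theorem:
  "(\<Prod>i<n. 1 + b * q ^ i) = (\<Sum>k\<le>n. qbin q n k * q ^ (k * (k - 1) div 2) * b ^ k)"
proof (induction n arbitrary: b)
  case (Suc n)
  define s where "s = (\<lambda>k. q ^ (k * (k - 1) div 2))"
  have s: "s (Suc k) = s k * q ^ k" for k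
    unfolding s_def diff_Suc_1 triangle_Suc by (simp add: power_add)
  have "(\<Prod>i<Suc n. 1 + b * q ^ i) = (1 + b) * (\<Prod>i<n. 1 + (b * q) * q ^ i)"
    by (subst prod.lessThan_Suc_shift) (simp add: mult_ac)
  also have "\<dots> = (1 + b) * (\<Sum>k\<le>n. qbin q n k * s k * (b * q) ^ k)"
    by (simp add: Suc s_def)
  also have "\<dots> = (\<Sum>k\<le>Suc n. qbin q n k * s k * (b * q) ^ k)
      + b * (\<Sum>k\<le>n. qbin q n k * s k * (b * q) ^ k)"
    by (simp add: algebra_simps qbin_eq_0)
  also have "\<dots> = 1 + ((\<Sum>k\<le>n. qbin q n (Suc k) * s (Suc k) * (b * q) ^ Suc k)
      + (\<Sum>k\<le>n. qbin q n k * s (Suc k) * b ^ Suc k))"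
    by (subst sum.atMost_Suc_shift) (simp add: s power_mult_distrib sum_distrib_left mult_ac, simp add: s_def)
  also have "\<dots> = 1 + (\<Sum>k\<le>n. qbin q (Suc n) (Suc k) * s (Suc k) * b ^ Suc k)"
    by (simp add: sum.distrib[symmetric] algebra_simps power_mult_distrib)
  also have "\<dots> = (\<Sum>k\<le>Suc n. qbin q (Suc n) k * s k * b ^ k)"
    by (subst sum.atMost_Suc_shift) (simp add: s_def)
  finally show ?case by (simp add: s_def)
qed auto

section \<open>Finite form of Jacobi's triple product\<close>

definition theta_term :: "'a::comm_ring_1 \<Rightarrow> 'a \<Rightarrow> int \<Rightarrow> 'a" where
  "theta_term a b j = a ^ nat (j * (j + 1) div 2) * b ^ nat (j * (j - 1) div 2)"

lemma triangle_int_Suc: "(j + 1) * (j + 2) div 2 = j * (j + 1) div 2 + (j + 1)" for j :: int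
proof -
  have "(j + 1) * (j + 2) = j * (j + 1) + 2 * (j + 1)" by (simp add: algebra_simps)
  then show ?thesis by simp
qed

lemma triangle_int_nonneg: "0 \<le> j * (j + 1) div 2" "0 \<le> j * (j - 1) div 2" for j :: int
proof -
  have "0 \<le> j * (j + 1)" by (cases "j \<ge> 0") (auto intro!: mult_nonpos_nonpos)
  then show "0 \<le> j * (j + 1) div 2" by simp
  have "0 \<le> j * (j - 1)" by (cases "j \<ge> 1") (auto intro!: mult_nonpos_nonpos)
  then show "0 \<le> j * (j - 1) div 2" by simp
qed

text \<open>In essence \<open>theta_term a b (j + 1) = a * (a * b) ^ j * theta_term a b j\<close>;
  the factor \<open>(a * b) ^ nat (int m - j)\<close> keeps the exponents natural when
  \<open>j\<close> is negative.\<close>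

lemma theta_term_shift:
  assumes "j \<le> int m"
  shows "(a * b) ^ nat (int m - j) * theta_term a b (j + 1) = a * (a * b) ^ m * theta_term a b j"
proof -
  let ?t = "\<lambda>j::int. j * (j + 1) div 2"
  have t1: "?t (j + 1) = ?t j + (j + 1)" using triangle_int_Suc[of j] by (simp add: add.assoc)
  have t0: "?t j = ?t (j - 1) + j" using triangle_int_Suc[of "j - 1"] by (simp add: add.commute)
  have nn: "?t (j + 1) \<ge> 0" "?t j \<ge> 0" "?t (j - 1) \<ge> 0" by (rule triangle_int_nonneg)+
  have e: "(j + 1) * (j + 1 - 1) div 2 = ?t j" "j * (j - 1) div 2 = ?t (j - 1)"
    by (simp_all add: mult.commute)
  have ea: "nat (int m - j) + nat (?t (j + 1)) = Suc (m + nat (?t j))"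
    using t1 nn assms by linarith
  have eb: "nat (int m - j) + nat (?t j) = m + nat (?t (j - 1))"
    using t0 nn assms by linarith
  have "(a * b) ^ nat (int m - j) * theta_term a b (j + 1)
      = a ^ (nat (int m - j) + nat (?t (j + 1))) * b ^ (nat (int m - j) + nat (?t j))"
    unfolding theta_term_def e by (simp add: power_mult_distrib power_add mult_ac)
  also have "\<dots> = a * (a * b) ^ m * theta_term a b j"
    unfolding ea eb theta_term_def e by (simp add: power_mult_distrib power_add mult_ac)
  finally show ?thesis .
qed

text \<open>A truncation of Ramanujan's theta function of \<open>a\<close> and \<open>b\<close>,
  damped by Gaussian binomials in \<open>a * b\<close>. Weight \<open>1\<close> yields the triple
  product, weight \<open>j\<close> Jacobi's cube.\<close>

definition jtp_sum :: "'a::comm_ring_1 \<Rightarrow> 'a \<Rightarrow> (int \<Rightarrow> 'a) \<Rightarrow> nat \<Rightarrow> nat \<Rightarrow> 'a" where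
  "jtp_sum a b w m n =
     (\<Sum>j = - int n..int m. w j * (qbin (a * b) (m + n) (nat (int m - j)) * theta_term a b j))"

text \<open>The q-Pascal rule splits each Gaussian binomial; in the second part
  \<open>theta_term_shift\<close> trades the power of \<open>a * b\<close> for a shift of
  \<open>j\<close>, which moves the weight as well.\<close>

lemma jtp_sum_Suc:
  "jtp_sum a b w (Suc m) n = jtp_sum a b w m n + a * (a * b) ^ m * jtp_sum a b (\<lambda>j. w (j + 1)) m n"
proof -
  let ?q = "a * b" and ?N = "m + n" and ?T = "theta_term a b"
  let ?A = "\<lambda>j. w j * (qbin ?q ?N (nat (int m - j)) * ?T j)"
  let ?B = "\<lambda>j. a * ?q ^ m * (w (j + 1) * (qbin ?q ?N (nat (int m - j)) * ?T j))"
  \<comment> \<open>The top index \<open>j = int m + 1\<close> is special: there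
    \<open>nat (int m - j)\<close> truncates to \<open>0\<close>, so \<open>?A j\<close> would not
    vanish by itself.\<close>
  have split: "w j * (qbin ?q (Suc ?N) (nat (int (Suc m) - j)) * ?T j)
      = (if j = int m + 1 then 0 else ?A j) + ?B (j - 1)"
    if "j \<in> {- int n..int m + 1}" for j
  proof (cases "j = int m + 1")
    case True
    then show ?thesis using theta_term_shift[of "int m" m a b] by (simp add: mult_ac)
  next
    case False
    define k where "k = nat (int m - j)"
    have k: "nat (int (Suc m) - j) = Suc k" "nat (int m - (j - 1)) = Suc k"
      using False that by (auto simp: k_def nat_eq_iff)
    have "?q ^ Suc k * ?T j = a * ?q ^ m * ?T (j - 1)"
      using theta_term_shift[of "j - 1" m a b] that k by simp
    then have "w j * (?q ^ Suc k * qbin ?q ?N (Suc k) * ?T j)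
        = w j * (qbin ?q ?N (Suc k) * (a * ?q ^ m * ?T (j - 1)))"
      by (metis mult.assoc mult.commute)
    then show ?thesis
      using False unfolding k by (simp add: k_def[symmetric] distrib_left distrib_right mult_ac)
  qed
  have "jtp_sum a b w (Suc m) n
      = (\<Sum>j = - int n..int m + 1. (if j = int m + 1 then 0 else ?A j) + ?B (j - 1))"
    unfolding jtp_sum_def by (rule sum.cong) (use split in \<open>auto simp: add.commute\<close>)
  also have "\<dots> = (\<Sum>j = - int n..int m + 1. if j = int m + 1 then 0 else ?A j)
      + (\<Sum>j = - int n..int m + 1. ?B (j - 1))"
    by (rule sum.distrib)
  also have "(\<Sum>j = - int n..int m + 1. if j = int m + 1 then 0 else ?A j) = jtp_sum a b w m n"
    unfolding jtp_sum_def by (rule sum.mono_neutral_cong_right) auto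
  also have "(\<Sum>j = - int n..int m + 1. ?B (j - 1)) = (\<Sum>j = - int n - 1..int m. ?B j)"
    by (rule sum.reindex_bij_witness[where i = "\<lambda>j. j + 1" and j = "\<lambda>j. j - 1"]) auto
  also have "\<dots> = (\<Sum>j = - int n..int m. ?B j)"
    by (rule sum.mono_neutral_right) (auto simp: qbin_eq_0)
  also have "\<dots> = a * ?q ^ m * jtp_sum a b (\<lambda>j. w (j + 1)) m n"
    unfolding jtp_sum_def by (simp add: sum_distrib_left)
  finally show ?thesis .
qed

text \<open>Only indices \<open>j = - k\<close> with \<open>k \<ge> 0\<close> occur, and the sum is
  the q-binomial theorem in \<open>b\<close>.\<close>

lemma jtp_sum_0: "jtp_sum a b (\<lambda>_. 1) 0 n = (\<Prod>i<n. 1 + b * (a * b) ^ i)"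
proof -
  have T: "theta_term a b (- int k) = (a * b) ^ (k * (k - 1) div 2) * b ^ k" for k
  proof -
    have "- int k * (- int k + 1) div 2 = int (k * (k - 1) div 2)"
      by (cases k) (auto simp: algebra_simps zdiv_int)
    moreover have "- int k * (- int k - 1) div 2 = int (Suc k * k div 2)"
      by (auto simp: algebra_simps zdiv_int)
    ultimately show ?thesis
      unfolding theta_term_def by (simp only: nat_int triangle_Suc power_mult_distrib power_add mult.assoc)
  qed
  have "jtp_sum a b (\<lambda>_. 1) 0 n = (\<Sum>k\<le>n. qbin (a * b) n k * theta_term a b (- int k))"
    unfolding jtp_sum_def
    by (rule sum.reindex_bij_witness[where i = "\<lambda>k. - int k" and j = "\<lambda>j. nat (- j)"]) auto
  then show ?thesis by (simp add: T q_binomial_theorem mult_ac)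
qed

text \<open>For constant weight both sums in \<open>jtp_sum_Suc\<close> coincide, so each increase
  of \<open>m\<close> multiplies by \<open>1 + a * (a * b) ^ m\<close>.\<close>

theorem finite_jacobi_triple_product:
  "jtp_sum a b (\<lambda>_. 1) m n = (\<Prod>i<m. 1 + a * (a * b) ^ i) * (\<Prod>i<n. 1 + b * (a * b) ^ i)"
  by (induction m) (simp_all add: jtp_sum_0 jtp_sum_Suc algebra_simps)

text \<open>At \<open>a = -1\<close> the triple product vanishes; the weight \<open>j\<close> extracts its derivative there.\<close>
lemma finite_jacobi_cube:
  "jtp_sum (- 1) (- q) of_int (Suc m) n = - (qfac q m * qfac q n)"
proof (induction m)
  case 0
  have "(\<Prod>i<n. 1 - q * q ^ i) = qfac q n"
    by (induction n) auto
  \<comment> \<open>In \<open>jtp_sum_Suc\<close> with \<open>a = -1\<close> and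
    \<open>m = 0\<close> the two sums weighted by \<open>j\<close> cancel, leaving minus the
    unweighted sum.\<close>
  moreover have "jtp_sum (- 1) (- q) (\<lambda>j. of_int (j + 1)) 0 n
      = jtp_sum (- 1) (- q) of_int 0 n + jtp_sum (- 1) (- q) (\<lambda>_. 1) 0 n"
    by (simp add: jtp_sum_def algebra_simps sum.distrib)
  ultimately show ?case
    by (simp add: jtp_sum_Suc jtp_sum_0 algebra_simps)
next
  case (Suc m)
  have "jtp_sum (- 1) (- q) (\<lambda>j. of_int (j + 1)) (Suc m) n
      = jtp_sum (- 1) (- q) of_int (Suc m) n + jtp_sum (- 1) (- q) (\<lambda>_. 1) (Suc m) n"
    by (simp add: jtp_sum_def algebra_simps sum.distrib)
  moreover have "jtp_sum (- 1) (- q) (\<lambda>_. 1) (Suc m) n = 0"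
    unfolding finite_jacobi_triple_product by (subst prod.lessThan_Suc_shift) simp
  ultimately show ?case
    using Suc by (subst jtp_sum_Suc) (simp add: algebra_simps)
qed

section \<open>Infinite products and theta series as formal power series\<close>

lemma fps_mult_nth_cong:
  assumes "\<And>i. i \<le> N \<Longrightarrow> fps_nth A i = fps_nth A' i" "\<And>i. i \<le> N \<Longrightarrow> fps_nth B i = fps_nth B' i"
    and "i \<le> N"
  shows "fps_nth (A * B) i = fps_nth (A' * B') i"
  unfolding fps_mult_nth using assms by (intro sum.cong) auto

text \<open>Convergence means that each coefficient is eventually constant, and a coefficient of a
  product involves only finitely many coefficients of the factors.\<close>

lemma tendsto_mult_fps:
  fixes f g :: "'b \<Rightarrow> 'a::comm_ring_1 fps"
  assumes "(f \<longlongrightarrow> A) F" "(g \<longlongrightarrow> B) F"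
  shows "((\<lambda>x. f x * g x) \<longlongrightarrow> A * B) F"
proof (rule tendsto_fpsI)
  fix n
  have "\<forall>\<^sub>F x in F. \<forall>i\<in>{..n}. fps_nth (f x) i = fps_nth A i \<and> fps_nth (g x) i = fps_nth B i"
    using assms by (intro eventually_ball_finite) (auto simp: tendsto_fps_iff intro: eventually_conj)
  then show "\<forall>\<^sub>F x in F. fps_nth (f x * g x) n = fps_nth (A * B) n"
    by eventually_elim (auto intro: fps_mult_nth_cong)
qed

text \<open>Factors with index beyond \<open>N\<close> change only coefficients beyond
  \<open>N\<close>, so any cut-off \<open>k \<ge> N\<close> gives the same coefficient.\<close>

lemma eta_prod_nth:
  assumes "d > 0" "N \<le> k"
  shows "fps_nth (qfac (fps_X ^ d) k) N = fps_nth (eta_prod d) N"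
  using assms(2)
proof (induction k rule: dec_induct)
  case base
  show ?case by (simp add: eta_prod_def qfac_def power_mult)
next
  case (step n)
  have "N < d * Suc n" using step(1) assms(1) by (metis le_imp_less_Suc less_le_trans mult_le_mono1 mult_1 Suc_leI One_nat_def)
  then show ?case
    using step by (simp add: right_diff_distrib power_mult[symmetric] fps_X_power_mult_right_nth del: power_Suc mult_Suc_right)
qed

lemma qfac_tendsto_eta:
  assumes "d > 0" "filterlim h at_top F"
  shows "((\<lambda>x. qfac (fps_X ^ d) (h x)) \<longlongrightarrow> eta_prod d) F"
proof (rule tendsto_fpsI)
  fix N
  have "\<forall>\<^sub>F x in F. N \<le> h x" using assms(2) by (auto simp: filterlim_at_top)
  then show "\<forall>\<^sub>F x in F. fps_nth (qfac (fps_X ^ d) (h x)) N = fps_nth (eta_prod d) N"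
    by eventually_elim (simp add: eta_prod_nth assms)
qed

lemma eta_prod_nth_0: "fps_nth (eta_prod d) 0 = 1"
  by (simp add: eta_prod_def)

lemma eta_prod_neq_0: "eta_prod d \<noteq> 0"
  using eta_prod_nth_0[of d] by auto

lemma eta_prod_compose:
  assumes "d > 0"
  shows "eta_prod d = eta_prod 1 oo fps_X ^ d"
proof -
  have "(\<lambda>n. qfac (fps_X ^ d) n) \<longlonglongrightarrow> (eta_prod 1 oo fps_X ^ d)"
  proof (rule tendsto_fpsI)
    fix N
    have 1: "fps_nth (qfac (fps_X ^ d :: rat fps) n) N = fps_nth (eta_prod 1 oo fps_X ^ d) N" if "N \<le> n" for n
    proof -
      have "qfac (fps_X ^ d) n = qfac (fps_X :: rat fps) n oo fps_X ^ d"
        unfolding qfac_def using assms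
        by (subst fps_compose_prod_distrib)
           (auto simp: fps_compose_sub_distrib fps_compose_power[symmetric])
      then show ?thesis
        using eta_prod_nth[of 1] that by (auto simp: fps_compose_nth intro!: sum.cong)
    qed
    show "\<forall>\<^sub>F n in sequentially. fps_nth (qfac (fps_X ^ d :: rat fps) n) N = fps_nth (eta_prod 1 oo fps_X ^ d) N"
      using eventually_ge_at_top[of N] by eventually_elim (rule 1)
  qed
  moreover have "(\<lambda>n. qfac (fps_X ^ d) n) \<longlonglongrightarrow> eta_prod d"
    by (rule qfac_tendsto_eta[OF assms filterlim_ident])
  ultimately show ?thesis using LIMSEQ_unique by blast
qed

text \<open>When \<open>k\<close> and \<open>n - k\<close> are large, the Gaussian binomial is close
  to \<open>1 / eta_prod d\<close>: in \<open>qbin_qfac\<close> all three partial products agree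
  with \<open>eta_prod d\<close> up to \<open>N\<close>, and one factor is cancelled.\<close>

lemma qbin_mult_eta_nth:
  assumes d: "d > 0" and N: "N \<le> k" "N \<le> n - k" "k \<le> n" and i: "i \<le> N"
  shows "fps_nth (qbin (fps_X ^ d) n k * eta_prod d) i = fps_nth 1 i"
proof -
  let ?g = "qbin (fps_X ^ d) n k :: rat fps" and ?f = "eta_prod d" and ?P = "qfac (fps_X ^ d) :: nat \<Rightarrow> rat fps"
  have f: "fps_nth (?P l) i = fps_nth ?f i" if "l \<ge> N" "i \<le> N" for l i
    using eta_prod_nth[OF d] that by simp
  have "fps_nth (?g * (?f * ?f)) i = fps_nth ?f i" if "i \<le> N" for i
  proof -
    have "fps_nth (?g * (?f * ?f)) i = fps_nth (?g * (?P k * ?P (n - k))) i"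
      by (rule fps_mult_nth_cong[OF refl fps_mult_nth_cong[of N] that]) (use f N in auto)
    then show ?thesis using f[of n i] that N by (simp add: qbin_qfac)
  qed
  then have "fps_nth ((?g * (?f * ?f)) * inverse ?f) i = fps_nth (?f * inverse ?f) i"
    using i by (intro fps_mult_nth_cong[where N = N]) auto
  moreover have "?f * inverse ?f = 1"
    by (rule inverse_mult_eq_1') (simp add: eta_prod_nth_0)
  then have "(?g * (?f * ?f)) * inverse ?f = ?g * ?f" by (simp add: mult.assoc)
  ultimately show ?thesis using \<open>?f * inverse ?f = 1\<close> by simp
qed

section \<open>Theta series as limits of the finite triple product\<close>

definition theta_series :: "(int \<Rightarrow> nat) \<Rightarrow> (int \<Rightarrow> rat) \<Rightarrow> rat fps" where
  "theta_series e w = Abs_fps (\<lambda>n. \<Sum>j | e j = n. w j)"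

text \<open>Makes the fibres of \<open>e\<close> finite; over an infinite fibre the sum in
  \<open>theta_series\<close> would default to \<open>0\<close>. The slack \<open>1\<close> admits
  triangular exponents, which vanish at \<open>j = 1\<close> or \<open>j = -1\<close> besides
  \<open>j = 0\<close>.\<close>

definition proper_exponent :: "(int \<Rightarrow> nat) \<Rightarrow> bool" where
  "proper_exponent e \<longleftrightarrow> (\<forall>j. \<bar>j\<bar> \<le> int (e j) + 1)"

lemma proper_exponent_fibre:
  assumes "proper_exponent e"
  shows "{j. e j = n} \<subseteq> {- int n - 1..int n + 1}"
proof
  fix j assume "j \<in> {j. e j = n}"
  moreover have "\<bar>j\<bar> \<le> int (e j) + 1" using assms by (simp add: proper_exponent_def)
  ultimately show "j \<in> {- int n - 1..int n + 1}" by auto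
qed

lemma finite_fibre: "proper_exponent e \<Longrightarrow> finite {j. e j = n}"
  by (rule finite_subset[OF proper_exponent_fibre]) auto

text \<open>Up to \<open>fps_X ^ N\<close>, terms with small \<open>j\<close> have their Gaussian
  factor equal to \<open>1\<close>, and all others have exponent above \<open>N\<close>. The offset
  \<open>c\<close> covers the range up to \<open>n + 1\<close> in the cube identity.\<close>

lemma qbin_sum_tendsto_theta:
  assumes d: "d > 0" and e: "proper_exponent e" and c: "c \<le> 1"
  shows "(\<lambda>n. \<Sum>j = - int n..int (n + c). fps_const (w j) * fps_X ^ e j *
             (qbin (fps_X ^ d) (n + c + n) (nat (int (n + c) - j)) * eta_prod d)) \<longlonglongrightarrow> theta_series e w"
proof (rule tendsto_fpsI)
  fix N
  let ?Q = "\<lambda>n j. qbin (fps_X ^ d) (n + c + n) (nat (int (n + c) - j)) * eta_prod d"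
  have *: "fps_nth (\<Sum>j = - int n..int (n + c). fps_const (w j) * fps_X ^ e j * ?Q n j) N = fps_nth (theta_series e w) N"
    \<comment> \<open>For \<open>\<bar>j\<bar> \<le> int N + 1\<close> this bound keeps both lower
      indices of the Gaussian binomial, \<open>n + c - j\<close> and \<open>n + j\<close>, at least
      \<open>N\<close>.\<close>
    if n: "n \<ge> 2 * N + 2" for n
  proof -
    have "fps_nth (fps_const (w j) * fps_X ^ e j * ?Q n j) N = (if e j = N then w j else 0)"
      if j: "j \<in> {- int n..int (n + c)}" for j
    proof (cases "\<bar>j\<bar> \<le> int N + 1")
      case True
      then have "fps_nth (?Q n j) i = fps_nth 1 i" if "i \<le> N" for i
        using n c that j by (intro qbin_mult_eta_nth[where N = N] d) auto
      then show ?thesis by (simp add: mult.assoc fps_X_power_mult_nth del: fps_mult_nth_0)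
    next
      case False
      moreover have "\<bar>j\<bar> \<le> int (e j) + 1" using e by (simp add: proper_exponent_def)
      ultimately have "N < e j" by linarith
      then show ?thesis by (simp add: mult.assoc fps_X_power_mult_nth)
    qed
    then have "fps_nth (\<Sum>j = - int n..int (n + c). fps_const (w j) * fps_X ^ e j * ?Q n j) N
        = (\<Sum>j = - int n..int (n + c). if e j = N then w j else 0)"
      by (simp add: fps_sum_nth)
    also have "\<dots> = (\<Sum>j\<in>{j \<in> {- int n..int (n + c)}. e j = N}. w j)"
      by (rule sum.inter_filter[symmetric]) auto
    also have "{j \<in> {- int n..int (n + c)}. e j = N} = {j. e j = N}"
      using proper_exponent_fibre[OF e, of N] n by fastforce
    finally show ?thesis by (simp add: theta_series_def)
  qed
  show "\<forall>\<^sub>F n in sequentially. fps_nth (\<Sum>j = - int n..int (n + c). fps_const (w j) * fps_X ^ e j * ?Q n j) N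
      = fps_nth (theta_series e w) N"
    by (rule eventually_mono[OF eventually_ge_at_top *])
qed

definition parity_sign :: "int \<Rightarrow> rat" where
  "parity_sign j = (if even j then 1 else - 1)"

text \<open>Parameters \<open>1 2\<close> give the pentagonal numbers, \<open>1 1\<close> the
  squares, and \<open>0 d\<close> the triangular numbers times \<open>d\<close>.\<close>

definition jtp_exponent :: "nat \<Rightarrow> nat \<Rightarrow> int \<Rightarrow> nat" where
  "jtp_exponent r s j = r * nat (j * (j + 1) div 2) + s * nat (j * (j - 1) div 2)"

lemma le_half_int: "2 * x \<le> y \<Longrightarrow> x \<le> y div 2" for x y :: int
  by linarith

lemma proper_jtp_exponent:
  assumes "r + s > 0"
  shows "proper_exponent (jtp_exponent r s)"
  unfolding proper_exponent_def
proof
  fix j :: int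
  have A: "\<bar>j\<bar> - 1 \<le> j * (j + 1) div 2"
  proof -
    have "2 * (\<bar>j\<bar> - 1) \<le> j * (j + 1)"
    proof (cases "j \<ge> 0")
      case True
      then have "j * j \<ge> j" by (cases "j = 0") auto
      then show ?thesis using True by (simp add: algebra_simps)
    next
      case False
      have "0 \<le> (j + 1) * (j + 2)" using False by (cases "j = -1") (auto intro!: mult_nonpos_nonpos)
      then show ?thesis using False by (simp add: algebra_simps)
    qed
    then show ?thesis by (rule le_half_int)
  qed
  have B: "\<bar>j\<bar> - 1 \<le> j * (j - 1) div 2"
  proof -
    have "2 * (\<bar>j\<bar> - 1) \<le> j * (j - 1)"
    proof (cases "j \<ge> 0")
      case True
      have "0 \<le> (j - 1) * (j - 2)" by (auto simp: zero_le_mult_iff)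
      then show ?thesis using True by (simp add: algebra_simps)
    next
      case False
      have "0 \<le> j * (j + 1)" using False by (auto intro!: mult_nonpos_nonpos)
      then show ?thesis using False by (simp add: algebra_simps)
    qed
    then show ?thesis by (rule le_half_int)
  qed
  from assms consider "r > 0" | "s > 0" by auto
  then have "nat (j * (j + 1) div 2) \<le> jtp_exponent r s j \<or> nat (j * (j - 1) div 2) \<le> jtp_exponent r s j"
    by cases (auto simp: jtp_exponent_def intro: trans_le_add1 trans_le_add2)
  then show "\<bar>j\<bar> \<le> int (jtp_exponent r s j) + 1" using A B by linarith
qed

text \<open>The two triangular exponents add up to \<open>j * j\<close>, which has the parity of
  \<open>j\<close>; this determines the sign.\<close>

lemma theta_term_fps:
  "theta_term (- (fps_X ^ r)) (- (fps_X ^ s)) j = fps_const (parity_sign j) * fps_X ^ jtp_exponent r s j"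
proof -
  let ?a = "nat (j * (j + 1) div 2)" and ?b = "nat (j * (j - 1) div 2)"
  have "int (?a + ?b) = j * j"
  proof -
    have e: "even (j * (j + 1))" "even (j * (j - 1))" by auto
    have "int (?a + ?b) = j * (j + 1) div 2 + j * (j - 1) div 2"
      using triangle_int_nonneg[of j] by simp
    also have "\<dots> = (j * (j + 1) + j * (j - 1)) div 2"
      using e by (simp add: div_plus_div_distrib_dvd_left)
    also have "j * (j + 1) + j * (j - 1) = 2 * (j * j)" by (simp add: algebra_simps)
    finally show ?thesis by simp
  qed
  then have "even (?a + ?b) \<longleftrightarrow> even j" by (metis even_mult_iff even_of_nat)
  then have sgn: "(- 1 :: rat fps) ^ (?a + ?b) = fps_const (parity_sign j)"
    by (simp add: parity_sign_def minus_one_power_iff del: even_add flip: fps_const_neg)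
  have "theta_term (- (fps_X ^ r)) (- (fps_X ^ s :: rat fps)) j
      = (- 1) ^ (?a + ?b) * fps_X ^ jtp_exponent r s j"
    unfolding theta_term_def jtp_exponent_def
    by (subst (1 2) power_minus) (simp add: power_add power_mult mult_ac)
  then show ?thesis by (simp add: sgn)
qed

text \<open>Here \<open>a * b\<close> is \<open>fps_X ^ (r + s)\<close>, and the factor
  \<open>eta_prod (r + s)\<close> makes the Gaussian binomials tend to \<open>1\<close>.\<close>

lemma jtp_sum_tendsto:
  assumes "r + s > 0" "c \<le> 1"
  shows "(\<lambda>n. jtp_sum (- (fps_X ^ r)) (- (fps_X ^ s)) (\<lambda>j. fps_const (w j)) (n + c) n * eta_prod (r + s))
      \<longlonglongrightarrow> theta_series (jtp_exponent r s) (\<lambda>j. parity_sign j * w j)"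
proof -
  have "jtp_sum (- (fps_X ^ r)) (- (fps_X ^ s)) (\<lambda>j. fps_const (w j)) (n + c) n * eta_prod (r + s)
     = (\<Sum>j = - int n..int (n + c). fps_const (parity_sign j * w j) * fps_X ^ jtp_exponent r s j *
             (qbin (fps_X ^ (r + s)) (n + c + n) (nat (int (n + c) - j)) * eta_prod (r + s)))" for n
    unfolding jtp_sum_def theta_term_fps sum_distrib_right
    by (intro sum.cong refl) (simp add: power_add mult_ac fps_const_mult[symmetric] del: fps_const_mult)
  then show ?thesis
    using qbin_sum_tendsto_theta[OF assms(1) proper_jtp_exponent assms(2), of r s "\<lambda>j. parity_sign j * w j"] assms(1)
    by simp
qed

section \<open>Classical product identities of Euler, Gauss and Jacobi\<close>

lemma qfac_double: "qfac q (2 * n) = qfac (q ^ 2) n * (\<Prod>i<n. 1 - q * (q ^ 2) ^ i)"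
proof (induction n)
  case (Suc n)
  have *: "2 * Suc n = Suc (Suc (2 * n))" by simp
  have e: "q ^ Suc (2 * n) = q * (q ^ 2) ^ n" "q ^ Suc (Suc (2 * n)) = (q ^ 2) ^ Suc n"
    unfolding power_mult power_Suc by (simp_all add: power2_eq_square mult.assoc)
  show ?case unfolding * qfac_Suc e Suc prod.lessThan_Suc by (simp only: mult_ac)
qed simp

lemma qfac_triple:
  "qfac q (3 * n) = qfac (q ^ 3) n * ((\<Prod>i<n. 1 - q * (q ^ 3) ^ i) * (\<Prod>i<n. 1 - q ^ 2 * (q ^ 3) ^ i))"
proof (induction n)
  case (Suc n)
  have *: "3 * Suc n = Suc (Suc (Suc (3 * n)))" by simp
  have e: "q ^ Suc (3 * n) = q * (q ^ 3) ^ n" "q ^ Suc (Suc (3 * n)) = q ^ 2 * (q ^ 3) ^ n"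
    "q ^ Suc (Suc (Suc (3 * n))) = (q ^ 3) ^ Suc n"
    unfolding power_mult power_Suc by (simp_all add: power2_eq_square power3_eq_cube mult.assoc)
  show ?case unfolding * qfac_Suc e Suc prod.lessThan_Suc by (simp only: mult_ac)
qed simp

lemma filterlim_mult_at_top: "k > 0 \<Longrightarrow> filterlim (\<lambda>n. k * n) at_top sequentially" for k :: nat
  by (rule filterlim_subseq) (auto simp: strict_mono_def)

text \<open>With \<open>a = -q\<close> and \<open>b = -q^2\<close> the triple product supplies the
  exponents 1 and 2 modulo 3, and \<open>qfac (fps_X ^ 3) n\<close> the multiples of 3. The
  normalising \<open>eta_prod 3\<close> cancels in the limit.\<close>

theorem euler_pentagonal: "eta_prod 1 = theta_series (jtp_exponent 1 2) parity_sign"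
proof -
  let ?J = "\<lambda>n. jtp_sum (- (fps_X ^ 1)) (- (fps_X ^ 2)) (\<lambda>j. fps_const 1) n n :: rat fps"
  have eq: "qfac (fps_X ^ 3) n * (?J n * eta_prod 3) = qfac (fps_X ^ 1) (3 * n) * eta_prod 3" for n
    unfolding fps_const_1_eq_1 finite_jacobi_triple_product qfac_triple
    by (simp add: power2_eq_square power3_eq_cube mult_ac)
  have lim1: "(\<lambda>n. qfac (fps_X ^ 3) n * (?J n * eta_prod 3))
      \<longlonglongrightarrow> eta_prod 3 * theta_series (jtp_exponent 1 2) (\<lambda>j. parity_sign j * 1)"
    using jtp_sum_tendsto[of 1 2 0 "\<lambda>_. 1"]
    by (intro tendsto_mult_fps qfac_tendsto_eta filterlim_ident) (simp_all add: numeral_3_eq_3)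
  have lim2: "(\<lambda>n. qfac (fps_X ^ 1) (3 * n) * eta_prod 3) \<longlonglongrightarrow> eta_prod 1 * eta_prod 3"
    by (intro tendsto_mult_fps qfac_tendsto_eta filterlim_mult_at_top tendsto_const) auto
  have "eta_prod 3 * theta_series (jtp_exponent 1 2) (\<lambda>j. parity_sign j * 1) = eta_prod 1 * eta_prod 3"
    by (rule LIMSEQ_unique[OF lim1[unfolded eq] lim2])
  then show ?thesis using eta_prod_neq_0[of 3] by simp
qed

text \<open>With \<open>a = b = -q\<close> the triple product is the square of the product over odd
  exponents; two copies of \<open>qfac (fps_X ^ 2) n\<close> supply the even ones.\<close>

theorem gauss_square: "eta_prod 1 ^ 2 = eta_prod 2 * theta_series (jtp_exponent 1 1) parity_sign"
proof -
  let ?J = "\<lambda>n. jtp_sum (- (fps_X ^ 1)) (- (fps_X ^ 1)) (\<lambda>j. fps_const 1) n n :: rat fps"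
  let ?P = "\<lambda>d. qfac (fps_X ^ d) :: nat \<Rightarrow> rat fps"
  have eq: "?P 2 n * (?P 2 n * (?J n * eta_prod 2)) = ?P 1 (2 * n) * (?P 1 (2 * n) * eta_prod 2)" for n
    unfolding fps_const_1_eq_1 finite_jacobi_triple_product qfac_double
    by (simp add: power2_eq_square mult_ac)
  have lim1: "(\<lambda>n. ?P 2 n * (?P 2 n * (?J n * eta_prod 2)))
      \<longlonglongrightarrow> eta_prod 2 * (eta_prod 2 * theta_series (jtp_exponent 1 1) (\<lambda>j. parity_sign j * 1))"
    using jtp_sum_tendsto[of 1 1 0 "\<lambda>_. 1"]
    by (intro tendsto_mult_fps qfac_tendsto_eta filterlim_ident) (simp_all add: numeral_2_eq_2)
  have lim2: "(\<lambda>n. ?P 1 (2 * n) * (?P 1 (2 * n) * eta_prod 2)) \<longlonglongrightarrow> eta_prod 1 * (eta_prod 1 * eta_prod 2)"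
    by (intro tendsto_mult_fps qfac_tendsto_eta filterlim_mult_at_top tendsto_const) auto
  have "eta_prod 2 * (eta_prod 2 * theta_series (jtp_exponent 1 1) (\<lambda>j. parity_sign j * 1))
      = eta_prod 1 * (eta_prod 1 * eta_prod 2)"
    by (rule LIMSEQ_unique[OF lim1[unfolded eq] lim2])
  then have "eta_prod 2 * (eta_prod 2 * theta_series (jtp_exponent 1 1) parity_sign) = eta_prod 2 * eta_prod 1 ^ 2"
    by (simp add: power2_eq_square mult_ac)
  then show ?thesis using eta_prod_neq_0[of 2] by simp
qed

text \<open>The limit of \<open>finite_jacobi_cube\<close>: two partial products and the normalising
  \<open>eta_prod d\<close> make up the cube.\<close>

theorem jacobi_cube:
  assumes "d > 0"
  shows "eta_prod d ^ 3 = - theta_series (jtp_exponent 0 d) (\<lambda>j. parity_sign j * of_int j)"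
proof -
  let ?J = "\<lambda>n. jtp_sum (- (fps_X ^ 0)) (- (fps_X ^ d)) (\<lambda>j. fps_const (of_int j)) (n + 1) n :: rat fps"
  let ?P = "qfac (fps_X ^ d) :: nat \<Rightarrow> rat fps"
  have eq: "?J n * eta_prod d = ?P n * (?P n * (- eta_prod d))" for n
    using finite_jacobi_cube[of "fps_X ^ d :: rat fps" n n] by (simp add: fps_of_int mult_ac)
  have lim1: "(\<lambda>n. ?J n * eta_prod d) \<longlonglongrightarrow> theta_series (jtp_exponent 0 d) (\<lambda>j. parity_sign j * of_int j)"
    using jtp_sum_tendsto[of 0 d 1 of_int] assms by simp
  have lim2: "(\<lambda>n. ?P n * (?P n * (- eta_prod d))) \<longlonglongrightarrow> eta_prod d * (eta_prod d * (- eta_prod d))"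
    using assms by (intro tendsto_mult_fps qfac_tendsto_eta filterlim_ident tendsto_const) auto
  have "theta_series (jtp_exponent 0 d) (\<lambda>j. parity_sign j * of_int j) = eta_prod d * (eta_prod d * (- eta_prod d))"
    by (rule LIMSEQ_unique[OF lim1[unfolded eq] lim2])
  then show ?thesis by (simp add: power3_eq_cube mult.assoc)
qed

text \<open>The even-exponent factors are the same for \<open>q\<close> and \<open>-q\<close>, while
  the odd ones pair up as \<open>(1 - x) * (1 + x) = 1 - x^2\<close>.\<close>

lemma eta_prod_mult_eta_prod_neg:
  "eta_prod 1 * (eta_prod 1 oo - fps_X) * eta_prod 4 = eta_prod 2 ^ 3"
proof -
  let ?P = "\<lambda>d. qfac (fps_X ^ d) :: nat \<Rightarrow> rat fps"
  have neg: "((\<lambda>n. qfac (- fps_X) (2 * n)) \<longlonglongrightarrow> (eta_prod 1 oo - fps_X))"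
  proof (rule tendsto_fpsI)
    fix N
    have *: "fps_nth (qfac (- fps_X) (2 * n)) N = fps_nth (eta_prod 1 oo - fps_X) N" if "N \<le> n" for n
    proof -
      have "qfac (- fps_X) (2 * n) = (qfac (fps_X ^ 1) (2 * n) :: rat fps) oo - fps_X"
        unfolding qfac_def
        by (subst fps_compose_prod_distrib)
           (auto simp: fps_compose_sub_distrib fps_compose_power[symmetric])
      then show ?thesis using that eta_prod_nth[of 1 N "2 * n"] by (simp add: fps_compose_uminus')
    qed
    show "\<forall>\<^sub>F n in sequentially. fps_nth (qfac (- fps_X) (2 * n)) N = fps_nth (eta_prod 1 oo - fps_X) N"
      by (rule eventually_mono[OF eventually_ge_at_top *])
  qed
  have eq: "?P 1 (2 * n) * qfac (- fps_X) (2 * n) * ?P 4 n = ?P 2 n * (?P 2 n * ?P 2 (2 * n))" for n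
  proof -
    have "(\<Prod>i<n. 1 - fps_X * (fps_X ^ 2) ^ i) * (\<Prod>i<n. 1 - (- fps_X) * (fps_X ^ 2) ^ i)
        = (\<Prod>i<n. 1 - fps_X ^ 2 * ((fps_X ^ 2) ^ 2) ^ i :: rat fps)"
      unfolding prod.distrib[symmetric]
      by (intro prod.cong refl) (simp add: algebra_simps power2_eq_square power_mult_distrib)
    then show ?thesis
      using qfac_double[of "fps_X :: rat fps" n] qfac_double[of "- fps_X :: rat fps" n]
        qfac_double[of "fps_X ^ 2 :: rat fps" n]
      by (simp add: mult_ac)
  qed
  have lim1: "(\<lambda>n. ?P 1 (2 * n) * qfac (- fps_X) (2 * n) * ?P 4 n)
      \<longlonglongrightarrow> eta_prod 1 * (eta_prod 1 oo - fps_X) * eta_prod 4"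
    by (intro tendsto_mult_fps qfac_tendsto_eta filterlim_mult_at_top filterlim_ident neg) auto
  have lim2: "(\<lambda>n. ?P 2 n * (?P 2 n * ?P 2 (2 * n))) \<longlonglongrightarrow> eta_prod 2 * (eta_prod 2 * eta_prod 2)"
    by (intro tendsto_mult_fps qfac_tendsto_eta filterlim_mult_at_top filterlim_ident) auto
  show ?thesis using LIMSEQ_unique[OF lim1[unfolded eq] lim2] by (simp add: power3_eq_cube mult.assoc)
qed

section \<open>The Wronskian of \<open>f\<^sub>1(q)\<close> and \<open>f\<^sub>1(-q)\<close>\<close>

lemma finite_pair_fibre:
  assumes "proper_exponent e" "proper_exponent e'"
  shows "finite {(i, j). e i + e' j = n}"
proof (rule finite_subset)
  show "{(i, j). e i + e' j = n} \<subseteq> (\<Union>k\<le>n. {i. e i = k} \<times> {j. e' j = n - k})" by auto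
  show "finite (\<Union>k\<le>n. {i. e i = k} \<times> {j. e' j = n - k})"
    using assms by (auto simp: finite_fibre)
qed

lemma theta_series_mult_nth:
  assumes "proper_exponent e" "proper_exponent e'"
  shows "fps_nth (theta_series e w * theta_series e' w') n
      = (\<Sum>(i, j) | e i + e' j = n. w i * w' j)"
proof -
  have "fps_nth (theta_series e w * theta_series e' w') n
      = (\<Sum>k\<le>n. \<Sum>(i, j)\<in>{i. e i = k} \<times> {j. e' j = n - k}. w i * w' j)"
    by (simp add: fps_mult_nth theta_series_def sum_product sum.cartesian_product atMost_atLeast0)
  also have "\<dots> = (\<Sum>(i, j)\<in>(\<Union>k\<le>n. {i. e i = k} \<times> {j. e' j = n - k}). w i * w' j)"
    by (rule sum.UNION_disjoint[symmetric]) (auto simp: finite_fibre assms)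
  also have "(\<Union>k\<le>n. {i. e i = k} \<times> {j. e' j = n - k}) = {(i, j). e i + e' j = n}" by auto
  finally show ?thesis .
qed

lemma fps_XD_theta_series: "fps_XD (theta_series e w) = theta_series e (\<lambda>j. of_nat (e j) * w j)"
  by (rule fps_ext) (simp add: theta_series_def sum_distrib_left)

lemma theta_series_compose_neg:
  "theta_series e w oo - fps_X = theta_series e (\<lambda>j. (- 1) ^ e j * w j)"
  by (rule fps_ext) (simp add: theta_series_def sum_distrib_left fps_compose_uminus')

lemma fps_XD_mult: "fps_XD (a * b) = fps_XD a * b + a * fps_XD (b :: 'a::comm_ring_1 fps)"
  by (simp add: fps_XD_def algebra_simps)

lemma jtp_exponent_1_1: "int (jtp_exponent 1 1 j) = j ^ 2"
proof -
  have "j * (j + 1) div 2 + j * (j - 1) div 2 = (j * (j + 1) + j * (j - 1)) div 2"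
    by (simp add: div_plus_div_distrib_dvd_left)
  also have "j * (j + 1) + j * (j - 1) = 2 * j ^ 2" by (simp add: algebra_simps power2_eq_square)
  finally show ?thesis
    using triangle_int_nonneg[of j] by (simp add: jtp_exponent_def)
qed

lemma jtp_exponent_0_4: "int (jtp_exponent 0 4 j) = 2 * j * (j - 1)"
proof -
  have "2 * (j * (j - 1) div 2) = j * (j - 1)" by (rule dvd_mult_div_cancel) auto
  then show ?thesis
    using triangle_int_nonneg[of j] by (simp add: jtp_exponent_def)
qed

text \<open>Completing the square in the pentagonal number; this turns a condition on two exponents
  into one on a sum of two squares.\<close>

lemma jtp_exponent_1_2: "24 * int (jtp_exponent 1 2 j) + 1 = (6 * j - 1) ^ 2"
proof -
  have "2 * (j * (j - 1) div 2) = j * (j - 1)" "2 * (j * (j + 1) div 2) = j * (j + 1)"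
    by (rule dvd_mult_div_cancel, simp)+
  then have "2 * int (jtp_exponent 1 2 j) = j * (j + 1) + 2 * (j * (j - 1))"
    using triangle_int_nonneg[of j] by (simp add: jtp_exponent_def)
  then show ?thesis by (simp add: algebra_simps power2_eq_square)
qed

lemma sum_swap_pairs:
  "(\<Sum>(i, j) | e i + e j = (n::nat). g i j) = (\<Sum>(i, j) | e i + e j = n. g j i)"
  by (rule sum.reindex_bij_witness[where i = prod.swap and j = prod.swap]) (auto simp: add.commute)

text \<open>The summation range is symmetric, so adding the sum with \<open>i\<close> and
  \<open>j\<close> exchanged antisymmetrises the exponents as well.\<close>

lemma wronskian_theta_nth:
  assumes e: "proper_exponent e"
  shows "2 * fps_nth (theta_series e v * fps_XD (theta_series e w) - theta_series e w * fps_XD (theta_series e v)) n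
     = (\<Sum>(i, j) | e i + e j = n. (v i * w j - w i * v j) * (of_nat (e j) - of_nat (e i)))"
    (is "2 * ?L = _")
proof -
  have L: "?L = (\<Sum>(i, j) | e i + e j = n. (v i * w j - w i * v j) * of_nat (e j))"
    by (simp add: fps_XD_theta_series theta_series_mult_nth e sum_subtractf[symmetric] case_prod_unfold algebra_simps)
  have "2 * ?L = ?L + (\<Sum>(i, j) | e i + e j = n. (v j * w i - w j * v i) * of_nat (e i))"
    unfolding L mult_2
    using sum_swap_pairs[where e = e and n = n and g = "\<lambda>i j. (v i * w j - w i * v j) * of_nat (e j)"] by simp
  then show ?thesis
    unfolding L by (simp add: sum.distrib[symmetric] case_prod_unfold algebra_simps)
qed

text \<open>The reflection \<open>j \<mapsto> 1 - j\<close> preserves the exponent and turns the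
  weight \<open>j\<close> into \<open>j - 1\<close>; the sum of both weights is the odd number
  \<open>2 * j - 1\<close>.\<close>

lemma jacobi_cube_symmetric:
  assumes "d > 0"
  shows "2 * eta_prod d ^ 3 = - theta_series (jtp_exponent 0 d) (\<lambda>j. parity_sign j * of_int (2 * j - 1))"
proof (rule fps_ext)
  fix n
  let ?S = "{j. jtp_exponent 0 d j = n}"
  have inv: "jtp_exponent 0 d (1 - j) = jtp_exponent 0 d j" for j
    by (simp add: jtp_exponent_def algebra_simps)
  have "(\<Sum>j\<in>?S. parity_sign j * of_int j) = (\<Sum>j\<in>?S. parity_sign (1 - j) * of_int (1 - j))"
    by (rule sum.reindex_bij_witness[where i = "\<lambda>j. 1 - j" and j = "\<lambda>j. 1 - j"]) (auto simp: inv)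
  also have "\<dots> = (\<Sum>j\<in>?S. parity_sign j * of_int (j - 1))"
    by (intro sum.cong) (auto simp: parity_sign_def)
  finally have "2 * (\<Sum>j\<in>?S. parity_sign j * of_int j)
      = (\<Sum>j\<in>?S. parity_sign j * of_int j) + (\<Sum>j\<in>?S. parity_sign j * of_int (j - 1))"
    by simp
  also have "\<dots> = (\<Sum>j\<in>?S. parity_sign j * of_int (2 * j - 1))"
    by (simp add: sum.distrib[symmetric] algebra_simps)
  finally show "fps_nth (2 * eta_prod d ^ 3) n
      = fps_nth (- theta_series (jtp_exponent 0 d) (\<lambda>j. parity_sign j * of_int (2 * j - 1))) n"
    by (simp add: jacobi_cube[OF assms] theta_series_def numeral_fps_const)
qed

text \<open>Rotating the lattice by 45 degrees, \<open>(i, j) \<mapsto> (i - j, i + j - 1)\<close>, turns the square of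
  Jacobi's series into the Wronskian of the theta functions \<open>\<phi>(-q)\<close> and \<open>\<phi>(q)\<close>.\<close>
lemma phi_wronskian:
  defines "A \<equiv> theta_series (jtp_exponent 1 1) parity_sign"
  shows "A * fps_XD (A oo - fps_X) - (A oo - fps_X) * fps_XD A = 4 * fps_X * eta_prod 4 ^ 6"
proof (rule fps_ext)
  fix n
  let ?e = "jtp_exponent 1 1" and ?c = "jtp_exponent 0 4"
  have e: "proper_exponent ?e" and c: "proper_exponent ?c" by (auto intro: proper_jtp_exponent)
  have e_parity: "even (?e j) \<longleftrightarrow> even j" for j
    using jtp_exponent_1_1[of j] by (metis even_of_nat even_power pos2)
  have B: "A oo - fps_X = theta_series ?e (\<lambda>_. 1)"
    \<comment> \<open>The exponent is \<open>j ^ 2\<close>, so the sign from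
      \<open>q \<mapsto> -q\<close> cancels \<open>parity_sign j\<close>.\<close>
    unfolding A_def theta_series_compose_neg
    by (rule arg_cong[where f = "theta_series ?e"]) (auto simp: fun_eq_iff parity_sign_def e_parity minus_one_power_iff simp del: One_nat_def)
  let ?w = "\<lambda>j. parity_sign j * of_int (2 * j - 1)"
  have "4 * fps_X * eta_prod 4 ^ 6 = fps_X * (2 * eta_prod 4 ^ 3) * (2 * eta_prod 4 ^ 3)"
    by (simp add: power_add[symmetric])
  also have "\<dots> = fps_X * (theta_series ?c ?w * theta_series ?c ?w)"
    by (simp only: jacobi_cube_symmetric zero_less_numeral) (simp add: mult.assoc)
  finally have "fps_nth (4 * fps_X * eta_prod 4 ^ 6) n
      = fps_nth (fps_X * (theta_series ?c ?w * theta_series ?c ?w)) n"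
    by (simp only:)
  also have "\<dots> = (\<Sum>(i, j) | ?c i + ?c j + 1 = n. ?w i * ?w j)"
    by (cases n) (auto simp: theta_series_mult_nth[OF c c])
  finally have R: "fps_nth (4 * fps_X * eta_prod 4 ^ 6) n
      = (\<Sum>(i, j) | ?c i + ?c j + 1 = n. ?w i * ?w j)" .
  have "2 * fps_nth (A * fps_XD (A oo - fps_X) - (A oo - fps_X) * fps_XD A) n
      = (\<Sum>(i, j) | ?e i + ?e j = n. (parity_sign i - parity_sign j) * (of_nat (?e j) - of_nat (?e i)))"
    unfolding B unfolding A_def using wronskian_theta_nth[OF e] by simp
  \<comment> \<open>Pairs of equal parity contribute nothing; for opposite parity the difference of
    signs is \<open>2 * parity_sign i\<close>.\<close>
  also have "\<dots> = (\<Sum>(i, j) | ?e i + ?e j = n \<and> odd (i + j). 2 * parity_sign i * of_int (j ^ 2 - i ^ 2))"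
  proof (rule sum.mono_neutral_cong_right)
    show "finite {(i, j). ?e i + ?e j = n}" by (rule finite_pair_fibre[OF e e])
    have *: "(of_nat (?e j) :: rat) = of_int (j ^ 2)" for j
      using jtp_exponent_1_1[of j] by (metis of_int_of_nat_eq)
    show "(case x of (i, j) \<Rightarrow> (parity_sign i - parity_sign j) * (of_nat (?e j) - of_nat (?e i)))
        = (case x of (i, j) \<Rightarrow> 2 * parity_sign i * of_int (j ^ 2 - i ^ 2))"
      if "x \<in> {(i, j). ?e i + ?e j = n \<and> odd (i + j)}" for x
      using that unfolding * by (auto simp: parity_sign_def)
  qed (auto simp: parity_sign_def split: if_splits)
  \<comment> \<open>With \<open>m = t - s\<close> and \<open>k = t + s + 1\<close>,
    \<open>m^2 + k^2 = 2t(t+1) + 2s(s+1) + 1\<close> matches the exponents, and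
    \<open>k^2 - m^2 = (2t+1)(2s+1)\<close> the weights.\<close>
  also have "\<dots> = (\<Sum>(i, j) | ?c i + ?c j + 1 = n. 2 * (?w i * ?w j))"
  proof (rule sum.reindex_bij_witness[where
        j = "\<lambda>(m, k). ((m + k + 1) div 2, (k - m + 1) div 2)" and i = "\<lambda>(i, j). (i - j, i + j - 1)"])
    fix x :: "int \<times> int" assume "x \<in> {(i, j). ?e i + ?e j = n \<and> odd (i + j)}"
    then obtain m k where x: "x = (m, k)" "?e m + ?e k = n" "odd (m + k)" by auto
    from x(3) obtain t where t: "m + k = 2 * t + 1" by (rule oddE)
    define s where "s = t - m"
    have mk: "m = t - s" "k = t + s + 1" using t by (auto simp: s_def)
    have d: "(m + k + 1) div 2 = t + 1" "(k - m + 1) div 2 = s + 1" unfolding mk by auto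
    have n: "int n = m ^ 2 + k ^ 2" using x(2) jtp_exponent_1_1[of m] jtp_exponent_1_1[of k] by auto
    show "(case case x of (m, k) \<Rightarrow> ((m + k + 1) div 2, (k - m + 1) div 2) of (i, j) \<Rightarrow> (i - j, i + j - 1)) = x"
      by (simp add: x d) (simp add: mk)
    have "int (?c (t + 1) + ?c (s + 1) + 1) = int n"
      unfolding n mk of_nat_add jtp_exponent_0_4 by (simp add: algebra_simps power2_eq_square)
    then show "(case x of (m, k) \<Rightarrow> ((m + k + 1) div 2, (k - m + 1) div 2)) \<in> {(i, j). ?c i + ?c j + 1 = n}"
      by (simp add: x d del: of_nat_add of_nat_Suc)
    have "k ^ 2 - m ^ 2 = (2 * (t + 1) - 1) * (2 * (s + 1) - 1)"
      unfolding mk by (simp add: algebra_simps power2_eq_square)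
    moreover have "parity_sign m = parity_sign (t + 1) * parity_sign (s + 1)"
      unfolding mk by (auto simp: parity_sign_def)
    ultimately have "2 * parity_sign m * of_int (k ^ 2 - m ^ 2) = 2 * (?w (t + 1) * ?w (s + 1))"
      by (simp only: of_int_mult mult_ac)
    then show "(case case x of (m, k) \<Rightarrow> ((m + k + 1) div 2, (k - m + 1) div 2) of (i, j) \<Rightarrow> 2 * (?w i * ?w j))
        = (case x of (i, j) \<Rightarrow> 2 * parity_sign i * of_int (j ^ 2 - i ^ 2))"
      by (simp only: x d prod.case)
  next
    fix y :: "int \<times> int" assume "y \<in> {(i, j). ?c i + ?c j + 1 = n}"
    then obtain i j where y: "y = (i, j)" "?c i + ?c j + 1 = n" by auto
    have "(i - j + (i + j - 1) + 1) div 2 = i" "(i + j - 1 - (i - j) + 1) div 2 = j" by auto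
    then show "(case case y of (i, j) \<Rightarrow> (i - j, i + j - 1) of (m, k) \<Rightarrow> ((m + k + 1) div 2, (k - m + 1) div 2)) = y"
      by (simp only: y prod.case)
    have "int (?e (i - j) + ?e (i + j - 1)) = int n"
      unfolding y(2)[symmetric] of_nat_add jtp_exponent_0_4 jtp_exponent_1_1
      by (simp add: algebra_simps power2_eq_square)
    then show "(case y of (i, j) \<Rightarrow> (i - j, i + j - 1)) \<in> {(i, j). ?e i + ?e j = n \<and> odd (i + j)}"
      by (simp add: y(1) del: of_nat_add)
  qed
  also have "\<dots> = 2 * (\<Sum>(i, j) | ?c i + ?c j + 1 = n. ?w i * ?w j)"
    by (simp add: sum_distrib_left case_prod_unfold)
  finally show "fps_nth (A * fps_XD (A oo - fps_X) - (A oo - fps_X) * fps_XD A) n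
      = fps_nth (4 * fps_X * eta_prod 4 ^ 6) n"
    unfolding R by simp
qed

text \<open>Squaring both functions multiplies their Wronskian by \<open>2 * f * g\<close>, and a
  common factor \<open>?h\<close> comes out as \<open>?h ^ 2\<close>. Thus
  \<open>f * f = ?h * A\<close> and \<open>g * g = ?h * B\<close> reduce the claim to
  \<open>phi_wronskian\<close>, and \<open>fgk\<close> eliminates \<open>f * g\<close>.\<close>

lemma eta_wronskian:
  defines "f \<equiv> eta_prod 1"
  shows "eta_prod 2 * (f * fps_XD (f oo - fps_X) - (f oo - fps_X) * fps_XD f) = 2 * fps_X * eta_prod 4 ^ 7"
proof -
  define A where "A = theta_series (jtp_exponent 1 1) parity_sign"
  define g where "g = f oo - fps_X"
  define B where "B = A oo - fps_X"
  let ?h = "eta_prod 2" and ?k = "eta_prod 4"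
  \<comment> \<open>\<open>?h\<close> is a series in \<open>q^2\<close>, hence unchanged by
    \<open>q \<mapsto> -q\<close>; so \<open>fA\<close> carries over to \<open>gB\<close>.\<close>
  have "?h oo - fps_X = ?h"
  proof -
    have "?h oo - fps_X = f oo (fps_X ^ 2 oo - fps_X)"
      using eta_prod_compose[of 2] by (simp add: fps_compose_assoc f_def)
    also have "fps_X ^ 2 oo - fps_X = (fps_X ^ 2 :: rat fps)"
      by (subst fps_compose_power[symmetric]) auto
    finally show ?thesis using eta_prod_compose[of 2] by (simp add: f_def)
  qed
  moreover have fA: "f * f = ?h * A"
    using gauss_square by (simp add: f_def A_def power2_eq_square)
  ultimately have gB: "g * g = ?h * B"
    unfolding g_def B_def by (metis fps_compose_mult_distrib fps_X_nth fps_neg_nth neg_equal_0_iff_equal zero_neq_one)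
  have fgk: "f * g * ?k = ?h ^ 3"
    using eta_prod_mult_eta_prod_neg by (simp add: f_def g_def)
  have AB: "A * fps_XD B - B * fps_XD A = 4 * fps_X * ?k ^ 6"
    using phi_wronskian by (simp add: A_def B_def)
  define W where "W = f * fps_XD g - g * fps_XD f"
  have "2 * (f * g) * W = (f * f) * fps_XD (g * g) - (g * g) * fps_XD (f * f)"
    unfolding W_def fps_XD_mult by (simp add: algebra_simps)
  also have "\<dots> = ?h ^ 2 * (A * fps_XD B - B * fps_XD A)"
    unfolding fA gB fps_XD_mult by (simp add: algebra_simps power2_eq_square)
  also have "\<dots> = 4 * fps_X * ?h ^ 2 * ?k ^ 6"
    unfolding AB by (simp add: algebra_simps)
  finally have "2 * (f * g * ?k) * W = 4 * fps_X * ?h ^ 2 * (?k ^ 6 * ?k)"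
    by (simp add: mult_ac)
  then have "(2 * ?h ^ 2) * (?h * W) = (2 * ?h ^ 2) * (2 * fps_X * ?k ^ 7)"
    unfolding fgk by (simp add: power_numeral_reduce algebra_simps)
  moreover have "2 * ?h ^ 2 \<noteq> 0" using eta_prod_neq_0[of 2] by simp
  ultimately show ?thesis unfolding W_def g_def by (metis mult_left_cancel)
qed

text \<open>The Wronskian equals \<open>2q F(q^2)\<close>, so its coefficient at
  \<open>2 * n + 1\<close> is twice that of \<open>F\<close> at \<open>n\<close>. The constant is
  \<open>96 = 2 * 2 * 24\<close>: this factor, the doubling in \<open>wronskian_theta_nth\<close>,
  and the 24 from completing squares.\<close>

lemma eta_quotient_nth:
  fixes n :: nat
  defines "F \<equiv> eta_prod 2 ^ 7 * inverse (eta_prod 1)"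
  defines "e \<equiv> jtp_exponent 1 2"
  shows "96 * fps_nth F n = (\<Sum>(i, j) | e i + e j = 2 * n + 1.
      parity_sign i * parity_sign j * ((- 1) ^ e j - (- 1) ^ e i) * of_int ((6 * j - 1) ^ 2 - (6 * i - 1) ^ 2))"
proof -
  let ?f = "eta_prod 1"
  let ?W = "?f * fps_XD (?f oo - fps_X) - (?f oo - fps_X) * fps_XD ?f"
  have X2: "fps_nth (fps_X ^ 2 :: rat fps) 0 = 0" by simp
  have "inverse ?f * ?f = 1" by (rule inverse_mult_eq_1) (simp add: eta_prod_nth_0)
  then have "?f * F = eta_prod 2 ^ 7" by (simp add: F_def mult_ac)
  then have "(?f oo fps_X ^ 2) * (F oo fps_X ^ 2) = (eta_prod 2 oo fps_X ^ 2) ^ 7"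
    by (metis X2 fps_compose_mult_distrib fps_compose_power)
  moreover have "eta_prod 2 oo fps_X ^ 2 = eta_prod 4"
  proof -
    have "eta_prod 2 oo fps_X ^ 2 = ?f oo (fps_X ^ 2 oo fps_X ^ 2)"
      using eta_prod_compose[of 2] by (simp add: fps_compose_assoc)
    also have "fps_X ^ 2 oo fps_X ^ 2 = (fps_X ^ 4 :: rat fps)"
      by (subst fps_compose_power[symmetric]) (auto simp: power_mult[symmetric])
    finally show ?thesis using eta_prod_compose[of 4] by simp
  qed
  ultimately have "eta_prod 2 * (F oo fps_X ^ 2) = eta_prod 4 ^ 7"
    using eta_prod_compose[of 2] by simp
  then have "eta_prod 2 * ?W = eta_prod 2 * (2 * fps_X * (F oo fps_X ^ 2))"
    using eta_wronskian by (simp add: mult_ac)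
  then have W: "?W = 2 * fps_X * (F oo fps_X ^ 2)"
    using eta_prod_neq_0[of 2] by (metis mult_left_cancel)
  have "fps_nth (F oo fps_X ^ 2) (2 * n) = fps_nth F n"
  proof -
    have "fps_nth (F oo fps_X ^ 2) (2 * n) = (\<Sum>i\<in>{0..2 * n}. if i = n then fps_nth F i else 0)"
      unfolding fps_compose_nth by (intro sum.cong refl) (auto simp: power_mult[symmetric])
    then show ?thesis by simp
  qed
  then have "fps_nth ?W (2 * n + 1) = 2 * fps_nth F n"
    unfolding W by (simp add: mult.assoc numeral_fps_const)
  moreover have e: "proper_exponent e" unfolding e_def by (rule proper_jtp_exponent) simp
  have "2 * fps_nth ?W (2 * n + 1)
     = (\<Sum>(i, j) | e i + e j = 2 * n + 1. (parity_sign i * ((- 1) ^ e j * parity_sign j)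
          - (- 1) ^ e i * parity_sign i * parity_sign j) * (of_nat (e j) - of_nat (e i)))"
    unfolding euler_pentagonal e_def[symmetric] theta_series_compose_neg
    using wronskian_theta_nth[OF e] by simp
  ultimately have "96 * fps_nth F n
     = 24 * (\<Sum>(i, j) | e i + e j = 2 * n + 1. (parity_sign i * ((- 1) ^ e j * parity_sign j)
          - (- 1) ^ e i * parity_sign i * parity_sign j) * (of_nat (e j) - of_nat (e i)))"
    by simp
  also have "\<dots> = (\<Sum>(i, j) | e i + e j = 2 * n + 1.
      parity_sign i * parity_sign j * ((- 1) ^ e j - (- 1) ^ e i) * (24 * (of_nat (e j) - of_nat (e i))))"
    by (simp add: sum_distrib_left case_prod_unfold algebra_simps)
  also have "\<dots> = (\<Sum>(i, j) | e i + e j = 2 * n + 1.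
      parity_sign i * parity_sign j * ((- 1) ^ e j - (- 1) ^ e i) * of_int ((6 * j - 1) ^ 2 - (6 * i - 1) ^ 2))"
  proof -
    have "24 * (of_nat (e j) - of_nat (e i)) = (of_int ((6 * j - 1) ^ 2 - (6 * i - 1) ^ 2) :: rat)" for i j
      unfolding jtp_exponent_1_2[symmetric] e_def by simp
    then show ?thesis by simp
  qed
  finally show ?thesis .
qed

section \<open>Congruences\<close>

text \<open>Otherwise raising \<open>x^2 = -y^2\<close> to the power \<open>(p - 1) / 2\<close>,
  which is odd, gives \<open>1 = -1\<close> modulo \<open>p\<close> by Fermat's little
  theorem.\<close>

lemma prime_3_mod_4_dvd_sum_squares:
  fixes p :: nat and x y :: int
  assumes p: "prime p" and p4: "p mod 4 = 3" and dvd: "int p dvd x ^ 2 + y ^ 2"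
  shows "int p dvd x"
proof (rule ccontr)
  assume nx: "\<not> int p dvd x"
  have prime: "prime (int p)" using p by simp
  have ny: "\<not> int p dvd y"
  proof
    assume "int p dvd y"
    then have "int p dvd (x ^ 2 + y ^ 2) - y ^ 2" using dvd by (intro dvd_diff) (simp_all add: power2_eq_square)
    then show False using nx prime by (simp add: prime_dvd_power_iff)
  qed
  define k where "k = p div 4"
  have pk: "p - 1 = 2 * (2 * k + 1)" using p4 unfolding k_def by presburger
  have fermat: "[z ^ (p - 1) = 1] (mod int p)" if "\<not> int p dvd z" for z
  proof -
    have "\<not> p dvd nat \<bar>z\<bar>" using that by simp
    then have "[int (nat \<bar>z\<bar> ^ (p - 1)) = int 1] (mod int p)"
      unfolding cong_int_iff by (rule fermat_theorem[OF p])
    moreover have "even (p - 1)" unfolding pk by simp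
    ultimately show ?thesis by (simp add: power_even_abs)
  qed
  have "[x ^ 2 = - (y ^ 2)] (mod int p)" using dvd by (simp add: cong_iff_dvd_diff)
  then have "[(x ^ 2) ^ (2 * k + 1) = (- (y ^ 2)) ^ (2 * k + 1)] (mod int p)" by (rule cong_pow)
  then have "[x ^ (p - 1) = - (y ^ (p - 1))] (mod int p)"
    unfolding pk power_mult by simp
  then have "[1 = - 1] (mod int p)"
    using fermat[OF nx] fermat[OF ny]
    by (meson cong_minus_minus_iff cong_sym cong_trans)
  then have "int p dvd 2" by (simp add: cong_iff_dvd_diff)
  then have "p \<le> 2" using zdvd_imp_le by fastforce
  then show False using p4 by (cases "p = 0") auto
qed

section \<open>Divisibility of the coefficients of rational power series\<close>

definition coeffs_dvd :: "int \<Rightarrow> rat fps \<Rightarrow> bool" where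
  "coeffs_dvd m A \<longleftrightarrow> (\<forall>n. zero_mod (fps_nth A n) m)"

lemma zero_mod_0 [simp]: "zero_mod 0 m"
  by (auto simp: zero_mod_def intro: exI[of _ 0])

lemma zero_mod_add: "zero_mod x m \<Longrightarrow> zero_mod y m \<Longrightarrow> zero_mod (x + y) m"
  unfolding zero_mod_def by (metis distrib_left of_int_add)

lemma zero_mod_minus: "zero_mod x m \<Longrightarrow> zero_mod (- x) m"
  unfolding zero_mod_def by (metis mult_minus_right of_int_minus)

lemma zero_mod_mult: "zero_mod x m \<Longrightarrow> zero_mod y k \<Longrightarrow> zero_mod (x * y) (m * k)"
proof -
  assume "zero_mod x m" "zero_mod y k"
  then obtain a b where "x = of_int (m * a)" "y = of_int (k * b)" by (auto simp: zero_mod_def)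
  then have "x * y = of_int (m * k * (a * b))" by simp
  then show ?thesis unfolding zero_mod_def by blast
qed

lemma zero_mod_sum: "(\<And>i. i \<in> S \<Longrightarrow> zero_mod (f i) m) \<Longrightarrow> zero_mod (sum f S) m"
  by (induction S rule: infinite_finite_induct) (auto intro: zero_mod_add)

lemma zero_mod_of_int: "zero_mod (of_int a) m \<longleftrightarrow> m dvd a"
  unfolding zero_mod_def of_int_eq_iff dvd_def ..

lemma coeffs_dvd_add: "coeffs_dvd m A \<Longrightarrow> coeffs_dvd m B \<Longrightarrow> coeffs_dvd m (A + B)"
  by (simp add: coeffs_dvd_def zero_mod_add)

lemma coeffs_dvd_minus: "coeffs_dvd m A \<Longrightarrow> coeffs_dvd m (- A)"
  by (simp add: coeffs_dvd_def zero_mod_minus)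

lemma coeffs_dvd_diff: "coeffs_dvd m A \<Longrightarrow> coeffs_dvd m B \<Longrightarrow> coeffs_dvd m (A - B)"
  using coeffs_dvd_add[OF _ coeffs_dvd_minus] by fastforce

text \<open>Modulus \<open>1\<close> encodes integrality, so \<open>k = 1\<close> is multiplication
  by an integral series.\<close>

lemma coeffs_dvd_mult: "coeffs_dvd m A \<Longrightarrow> coeffs_dvd k B \<Longrightarrow> coeffs_dvd (m * k) (A * B)"
  unfolding coeffs_dvd_def fps_mult_nth by (auto intro!: zero_mod_sum zero_mod_mult)

lemma coeffs_dvd_1: "coeffs_dvd 1 1"
  unfolding coeffs_dvd_def zero_mod_def by (auto intro: exI[of _ 0] exI[of _ 1])

lemma coeffs_dvd_X_power: "coeffs_dvd 1 (fps_X ^ n)"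
  unfolding coeffs_dvd_def zero_mod_def by (auto intro: exI[of _ 0] exI[of _ 1])

lemma coeffs_dvd_power: "coeffs_dvd 1 A \<Longrightarrow> coeffs_dvd 1 (A ^ n)"
  using coeffs_dvd_mult[of 1 _ 1] by (induction n) (auto simp: coeffs_dvd_1)

lemma coeffs_dvd_prod: "(\<And>i. i \<in> S \<Longrightarrow> coeffs_dvd 1 (f i)) \<Longrightarrow> coeffs_dvd 1 (prod f S)"
  using coeffs_dvd_mult[of 1 _ 1] by (induction S rule: infinite_finite_induct) (auto simp: coeffs_dvd_1)

text \<open>With constant term 1, the recursion for the coefficients of the inverse involves no
  division.\<close>

lemma coeffs_dvd_inverse:
  assumes A: "coeffs_dvd 1 A" and A0: "fps_nth A 0 = 1"
  shows "coeffs_dvd 1 (inverse A)"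
  unfolding coeffs_dvd_def
proof
  fix n
  show "zero_mod (fps_nth (inverse A) n) 1"
  proof (induction n rule: less_induct)
    case (less n)
    show ?case
    proof (cases n)
      case 0
      then show ?thesis using A0 by (auto simp: zero_mod_def intro: exI[of _ 1])
    next
      case (Suc k)
      have "fps_nth (inverse A * A) n = 0"
        using inverse_mult_eq_1[of A] A0 Suc by simp
      then have "fps_nth (inverse A) n = - (\<Sum>i<n. fps_nth (inverse A) i * fps_nth A (n - i))"
        by (simp add: fps_mult_nth atLeast0AtMost lessThan_Suc_atMost[symmetric] A0 eq_neg_iff_add_eq_0 add.commute)
      moreover have "zero_mod (\<Sum>i<n. fps_nth (inverse A) i * fps_nth A (n - i)) 1"
        using zero_mod_mult[of _ 1 _ 1] less A by (intro zero_mod_sum) (auto simp: coeffs_dvd_def)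
      ultimately show ?thesis by (simp add: zero_mod_minus)
    qed
  qed
qed

lemma coeffs_dvd_eta_prod: "coeffs_dvd 1 (eta_prod d)"
proof -
  have "coeffs_dvd 1 (\<Prod>m\<in>{1..n}. 1 - fps_X ^ (d * m))" for n
    by (intro coeffs_dvd_prod coeffs_dvd_diff coeffs_dvd_1 coeffs_dvd_X_power)
  then show ?thesis by (simp add: coeffs_dvd_def eta_prod_def)
qed

text \<open>All inner binomial coefficients are divisible by \<open>p\<close>; oddness of
  \<open>p\<close> fixes the sign of the last term.\<close>

lemma one_minus_power_prime:
  assumes p: "prime p" and "odd p" and Y: "coeffs_dvd 1 Y"
  shows "coeffs_dvd (int p) ((1 - Y) ^ p - (1 - Y ^ p))"
proof -
  have pos: "p > 0" using p by (simp add: prime_gt_0_nat)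
  have "(1 - Y) ^ p = (\<Sum>k\<le>p. of_nat (p choose k) * (- Y) ^ k)"
    using binomial_ring[of "- Y" 1 p] by simp
  also have "\<dots> = (\<Sum>k\<in>{0, p}. of_nat (p choose k) * (- Y) ^ k) + (\<Sum>k\<in>{1..<p}. of_nat (p choose k) * (- Y) ^ k)"
  proof -
    have "{..p} = {0, p} \<union> {1..<p}" using pos by auto
    then show ?thesis using pos by (simp only:) (rule sum.union_disjoint, auto)
  qed
  also have "(\<Sum>k\<in>{0, p}. of_nat (p choose k) * (- Y) ^ k) = 1 - Y ^ p"
    using pos \<open>odd p\<close> by (simp add: power_minus_odd)
  finally have "(1 - Y) ^ p - (1 - Y ^ p) = (\<Sum>k\<in>{1..<p}. of_nat (p choose k) * (- Y) ^ k)" by simp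
  moreover have "coeffs_dvd (int p) (of_nat (p choose k) * (- Y) ^ k)" if "k \<in> {1..<p}" for k
  proof -
    have "p dvd p choose k" using that p by (intro dvd_choose_prime) auto
    then have "zero_mod (of_int (int (p choose k))) (int p)"
      unfolding zero_mod_of_int int_dvd_int_iff .
    then have "coeffs_dvd (int p) (of_nat (p choose k))"
      unfolding coeffs_dvd_def fps_of_nat[symmetric] by simp
    from coeffs_dvd_mult[OF this coeffs_dvd_power[OF coeffs_dvd_minus[OF Y]]] show ?thesis by simp
  qed
  then have "coeffs_dvd (int p) (\<Sum>k\<in>{1..<p}. of_nat (p choose k) * (- Y) ^ k)"
    unfolding coeffs_dvd_def fps_sum_nth by (auto intro: zero_mod_sum)
  ultimately show ?thesis by simp
qed

lemma coeffs_dvd_mult_cong: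
  assumes "coeffs_dvd m (A - A')" "coeffs_dvd m (B - B')" "coeffs_dvd 1 A" "coeffs_dvd 1 B'"
  shows "coeffs_dvd m (A * B - A' * B')"
proof -
  have "A * B - A' * B' = A * (B - B') + (A - A') * B'" by (simp add: algebra_simps)
  then show ?thesis
    using coeffs_dvd_mult[OF assms(3,2)] coeffs_dvd_mult[OF assms(1,4)] by (simp add: coeffs_dvd_add)
qed

lemma coeffs_dvd_qfac: "coeffs_dvd 1 q \<Longrightarrow> coeffs_dvd 1 (qfac q n)"
  unfolding qfac_def by (intro coeffs_dvd_prod coeffs_dvd_diff coeffs_dvd_1 coeffs_dvd_power)

text \<open>The congruence holds factor by factor for the partial products, and the
  \<open>n\<close>-th coefficient only sees the first \<open>n\<close> factors.\<close>

lemma eta_prod_power_prime: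
  assumes p: "prime p" "odd p" and d: "d > 0"
  shows "coeffs_dvd (int p) (eta_prod d ^ p - eta_prod (d * p))"
proof -
  let ?P = "\<lambda>n. qfac (fps_X ^ d) n :: rat fps" and ?Q = "\<lambda>n. qfac (fps_X ^ (d * p)) n :: rat fps"
  have dp: "d * p > 0" using d p(1) by (simp add: prime_gt_0_nat)
  have fin: "coeffs_dvd (int p) (?P n ^ p - ?Q n)" for n
  proof (induction n)
    case 0
    show ?case by (simp add: coeffs_dvd_def)
  next
    case (Suc n)
    have "coeffs_dvd (int p) (?P n ^ p * (1 - (fps_X ^ d) ^ Suc n) ^ p - ?Q n * (1 - ((fps_X ^ d) ^ Suc n) ^ p))"
      by (intro coeffs_dvd_mult_cong Suc one_minus_power_prime p coeffs_dvd_power coeffs_dvd_qfac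
          coeffs_dvd_diff coeffs_dvd_1 coeffs_dvd_X_power)
    moreover have "((fps_X ^ d) ^ Suc n) ^ p = ((fps_X :: rat fps) ^ (d * p)) ^ Suc n"
      by (simp only: power_mult[symmetric] mult_ac)
    ultimately show ?case by (simp only: qfac_Suc power_mult_distrib)
  qed
  show ?thesis
    unfolding coeffs_dvd_def
  proof
    fix n
    have pw: "fps_nth (?P n ^ k) i = fps_nth (eta_prod d ^ k) i" if "i \<le> n" for k i
      using that
    proof (induction k arbitrary: i)
      case (Suc k)
      then show ?case unfolding power_Suc
        by (intro fps_mult_nth_cong[where N = n]) (auto simp: eta_prod_nth d)
    qed simp
    have "fps_nth (eta_prod d ^ p - eta_prod (d * p)) n = fps_nth (?P n ^ p - ?Q n) n"
      using pw[of n p] eta_prod_nth[OF dp, of n n] by simp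
    then show "zero_mod (fps_nth (eta_prod d ^ p - eta_prod (d * p)) n) (int p)"
      using fin[of n] by (simp add: coeffs_dvd_def)
  qed
qed

text \<open>In \<open>eta_quotient_nth\<close> every summand has
  \<open>(6 * i - 1)^2 + (6 * j - 1)^2 = 2 * (24 * n + 13)\<close>, so \<open>p\<close> divides both
  bases and hence the difference of squares.\<close>

lemma eta_quotient_dvd:
  assumes p: "prime p" "p mod 4 = 3" "p > 3" and n: "p dvd 24 * n + 13"
  shows "zero_mod (fps_nth (eta_prod 2 ^ 7 * inverse (eta_prod 1)) n) (int p)"
proof -
  let ?F = "eta_prod 2 ^ 7 * inverse (eta_prod 1)" and ?e = "jtp_exponent 1 2"
  have sign: "\<exists>s. parity_sign i * parity_sign j * ((- 1) ^ k - (- 1) ^ l) = of_int s" for i j k l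
    by (rule exI[of _ "(if even i then 1 else - 1) * (if even j then 1 else - 1) * ((- 1) ^ k - (- 1) ^ l)"])
       (simp add: parity_sign_def)
  have "zero_mod (parity_sign i * parity_sign j * ((- 1) ^ ?e j - (- 1) ^ ?e i)
      * of_int ((6 * j - 1) ^ 2 - (6 * i - 1) ^ 2)) (int p)" if "?e i + ?e j = 2 * n + 1" for i j
  proof -
    have "(6 * i - 1) ^ 2 + (6 * j - 1) ^ 2 = 24 * int (?e i + ?e j) + 2"
      unfolding jtp_exponent_1_2[symmetric] by simp
    also have "\<dots> = 2 * int (24 * n + 13)" unfolding that by simp
    finally have d: "int p dvd (6 * i - 1) ^ 2 + (6 * j - 1) ^ 2"
      using n by (metis dvd_mult int_dvd_int_iff)
    have "int p dvd 6 * i - 1"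
      by (rule prime_3_mod_4_dvd_sum_squares[OF p(1,2) d])
    moreover have "int p dvd 6 * j - 1"
      by (rule prime_3_mod_4_dvd_sum_squares[OF p(1,2)]) (use d in \<open>simp only: add.commute\<close>)
    ultimately have "int p dvd (6 * j - 1) ^ 2 - (6 * i - 1) ^ 2"
      unfolding power2_eq_square by (blast intro: dvd_diff dvd_mult)
    moreover obtain s where "parity_sign i * parity_sign j * ((- 1) ^ ?e j - (- 1) ^ ?e i) = of_int s"
      using sign by blast
    ultimately show ?thesis by (simp only: of_int_mult[symmetric] zero_mod_of_int dvd_mult)
  qed
  then have *: "zero_mod (96 * fps_nth ?F n) (int p)"
    unfolding eta_quotient_nth by (intro zero_mod_sum) auto
  \<comment> \<open>The coefficient is an integer and \<open>96 = 2^5 * 3\<close> is prime to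
    \<open>p\<close>, so the factor 96 can be removed.\<close>
  have "coeffs_dvd (1 * 1) ?F"
    by (intro coeffs_dvd_mult coeffs_dvd_power coeffs_dvd_inverse coeffs_dvd_eta_prod eta_prod_nth_0)
  then obtain a where a: "fps_nth ?F n = of_int a" by (auto simp: coeffs_dvd_def zero_mod_def)
  have "int p dvd 96 * a"
    using * unfolding a zero_mod_of_int[symmetric] by simp
  moreover have "\<not> p dvd 96"
  proof
    assume "p dvd 96"
    then have "p dvd 2 ^ 5 * 3" by simp
    then have "p dvd 2 \<or> p dvd 3" using p(1) by (metis prime_dvd_mult_iff prime_dvd_power)
    then show False using p(3) by (auto dest: dvd_imp_le)
  qed
  then have "\<not> int p dvd 96" by (metis int_dvd_int_iff of_nat_numeral)
  ultimately show ?thesis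
    using p(1) unfolding a zero_mod_of_int by (metis prime_dvd_mult_iff prime_nat_int_transfer)
qed

text \<open>With \<open>c = p - 6\<close> the exponent \<open>c - 1\<close> is \<open>p - 7\<close>,
  so the generating function \<open>A\<close> satisfies \<open>A * ?h ^ p = F\<close>. Replacing
  \<open>?h ^ p\<close> by \<open>?k\<close> costs only \<open>R\<close>, whose coefficients are
  divisible by \<open>p\<close>.\<close>

lemma a_gen_cong:
  assumes p: "prime p" "p mod 4 = 3" "p > 7" and r: "p dvd 24 * r + 13"
  shows "zero_mod (a_gen (p - 6) (p * n + r)) (int p)"
proof -
  let ?f = "eta_prod 1" and ?h = "eta_prod 2" and ?k = "eta_prod (2 * p)"
  define F where "F = ?h ^ 7 * inverse ?f"
  define A where "A = inverse (?f * ?h ^ (p - 7))"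
  define R where "R = ?h ^ p - ?k"
  define B where "B = inverse ?k"
  have odd: "odd p" using p(2) by presburger
  have inv: "inverse u * u = 1" if "fps_nth u 0 = 1" for u :: "rat fps"
    using inverse_mult_eq_1[of u] that by simp
  have "A * (?f * ?h ^ (p - 7)) = 1"
    unfolding A_def by (rule inv) (simp add: eta_prod_nth_0 fps_power_zeroth)
  moreover have "?h ^ p = ?h ^ (p - 7) * ?h ^ 7" using p(3) by (simp add: power_add[symmetric])
  ultimately have "A * ?h ^ p * ?f = ?h ^ 7" by (simp add: mult_ac)
  then have "A * ?h ^ p * (inverse ?f * ?f) = F" by (simp add: F_def mult_ac)
  then have AF: "A * ?h ^ p = F" using inv[of ?f] by (simp add: eta_prod_nth_0)
  have "B * ?k = 1" unfolding B_def by (rule inv) (simp add: eta_prod_nth_0)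
  moreover have "B * (F - R * A) = B * ?k * A"
    unfolding AF[symmetric] R_def by (simp add: algebra_simps)
  ultimately have AB: "A = B * (F - R * A)" by simp
  have A1: "coeffs_dvd 1 A"
  proof -
    have "coeffs_dvd (1 * 1) (?f * ?h ^ (p - 7))"
      by (intro coeffs_dvd_mult coeffs_dvd_power coeffs_dvd_eta_prod)
    then show ?thesis
      unfolding A_def by (intro coeffs_dvd_inverse) (simp_all add: eta_prod_nth_0 fps_power_zeroth)
  qed
  have R: "coeffs_dvd (int p * 1) (R * A)"
    unfolding R_def by (intro coeffs_dvd_mult A1 eta_prod_power_prime p odd) simp
  have B1: "coeffs_dvd 1 B"
    unfolding B_def by (intro coeffs_dvd_inverse coeffs_dvd_eta_prod eta_prod_nth_0)
  \<comment> \<open>\<open>B\<close> is a series in \<open>q^(2p)\<close>, so multiplying by it only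
    mixes indices in the same residue class modulo \<open>p\<close>.\<close>
  have B0: "fps_nth B i = 0" if "\<not> p dvd i" for i
  proof -
    have "B = inverse ?f oo fps_X ^ (2 * p)"
      unfolding B_def using p(3) eta_prod_compose[of "2 * p"]
      by (simp add: fps_inverse_compose eta_prod_nth_0)
    then show ?thesis
      using that by (auto simp: fps_compose_nth power_mult[symmetric] intro!: sum.neutral)
  qed
  have "zero_mod (fps_nth B i * fps_nth (F - R * A) (p * n + r - i)) (int p)" if "i \<le> p * n + r" for i
  proof (cases "p dvd i")
    case True
    have "p dvd 24 * (p * n + r - i) + 13"
    proof -
      have "24 * (p * n + r - i) + 13 + 24 * i = 24 * (p * n) + (24 * r + 13)" using that by simp
      moreover have "p dvd 24 * (p * n) + (24 * r + 13)" by (rule dvd_add[OF _ r]) simp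
      ultimately show ?thesis using True by (metis dvd_add_left_iff dvd_mult)
    qed
    then have "zero_mod (fps_nth F (p * n + r - i)) (int p)"
      unfolding F_def using p by (intro eta_quotient_dvd) auto
    then have "zero_mod (fps_nth F (p * n + r - i) + - fps_nth (R * A) (p * n + r - i)) (int p)"
      using R by (intro zero_mod_add zero_mod_minus) (auto simp: coeffs_dvd_def)
    moreover have "zero_mod (fps_nth B i) 1" using B1 by (simp add: coeffs_dvd_def)
    ultimately show ?thesis using zero_mod_mult[of "fps_nth B i" 1] by fastforce
  qed (simp add: B0)
  then have "zero_mod (fps_nth (B * (F - R * A)) (p * n + r)) (int p)"
    unfolding fps_mult_nth by (intro zero_mod_sum) auto
  then have "zero_mod (fps_nth A (p * n + r)) (int p)" using AB by simp
  then show ?thesis by (simp add: a_gen_def A_def)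
qed

theorem theorem1p1:
  fixes n :: nat
  shows "zero_mod (a_gen 37 (43 * n + 12)) 43 \<and>
         zero_mod (a_gen 41 (47 * n + 21)) 47 \<and>
         zero_mod (a_gen 53 (59 * n + 56)) 59 \<and>
         zero_mod (a_gen 61 (67 * n + 19)) 67 \<and>
         zero_mod (a_gen 65 (71 * n + 32)) 71 \<and>
         zero_mod (a_gen 73 (79 * n + 62)) 79 \<and>
         zero_mod (a_gen 77 (83 * n + 79)) 83"
proof -
  have "prime (43 :: nat)" "prime (47 :: nat)" "prime (59 :: nat)" "prime (67 :: nat)"
    "prime (71 :: nat)" "prime (79 :: nat)" "prime (83 :: nat)"
    by simp_all
  \<comment> \<open>The values of \<open>24 * r + 13\<close> are 7 * 43, 11 * 47, 23 * 59, 7 * 67,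
    11 * 71, 19 * 79 and 23 * 83.\<close>
  then show ?thesis
    using a_gen_cong[of 43 12 n] a_gen_cong[of 47 21 n] a_gen_cong[of 59 56 n] a_gen_cong[of 67 19 n]
      a_gen_cong[of 71 32 n] a_gen_cong[of 79 62 n] a_gen_cong[of 83 79 n]
    by simp
qed

end
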